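(* Let $\mathcal{S}=\{1,\dots,k\}$ be a finite state space, where $k\geq 1$ is an integer, and let $\kappa=(\kappa_{zs})_{z,s\in\mathcal{S}}$ be an irreducible transition kernel over $\mathcal{S}$. Then $\kappa$ has a unique invariant distribution $\pi$; that is, there exists exactly one distribution $\pi$ over $\mathcal{S}$ with $\pi^t\kappa=\pi^t$.
   Context: A transition kernel over $\mathcal{S}$ is a non-negative function $\kappa$ on $\mathcal{S}\times\mathcal{S}$ such that $\sum_{s\in\mathcal{S}}\kappa_{zs}=1$ for all $z\in\mathcal{S}$; it is identified with a matrix in $[0,1]^{k\times k}$ (a stochastic matrix). $\kappa^n$ denotes the $n$-fold matrix product of $\kappa$, and $(\kappa^n)_{zs}$ its entry in row $z$ and column $s$. A distribution over $\mathcal{S}$ is a (column) vector $\pi\in[0,1]^k$ with $\sum_{s\in\mathcal{S}}\pi_s=1$. A distribution $\pi$ is an invariant distribution of $\kappa$ if $\pi^t\kappa=\pi^t$, where $t$ denotes transposition. The kernel $\kappa$ is called irreducible if for every $z,s\in\mathcal{S}$ there exists an integer $n>0$ such that $(\kappa^n)_{zs}>0$. *)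

theory Defs
  imports "HOL-Analysis.Analysis"
begin

text \<open>
  The state space \<open>{1..k}\<close> is rendered as a finite index type \<open>'n\<close> with \<open>k = CARD('n)\<close>;
  types are inhabited, so \<open>k \<ge> 1\<close>. Entry \<open>(z, s)\<close> of a matrix is \<open>\<kappa> $ z $ s\<close>.
\<close>

definition transition_kernel :: "real ^ 'n ^ 'n \<Rightarrow> bool" where
  "transition_kernel \<kappa> \<longleftrightarrow>
     (\<forall>z s. 0 \<le> \<kappa> $ z $ s) \<and> (\<forall>z. (\<Sum>s\<in>UNIV. \<kappa> $ z $ s) = 1)"

text \<open>
  The operator \<open>^\<close> on \<open>real ^ 'n ^ 'n\<close> is the entrywise power, since \<open>*\<close> on vectors is
  componentwise; powers with respect to the matrix product \<open>**\<close> are therefore defined separately.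
\<close>

primrec matrix_power :: "real ^ 'n ^ 'n \<Rightarrow> nat \<Rightarrow> real ^ 'n ^ 'n" where
  "matrix_power \<kappa> 0 = mat 1"
| "matrix_power \<kappa> (Suc n) = matrix_power \<kappa> n ** \<kappa>"

definition distribution :: "real ^ 'n \<Rightarrow> bool" where
  "distribution \<pi> \<longleftrightarrow> (\<forall>s. \<pi> $ s \<in> {0..1}) \<and> (\<Sum>s\<in>UNIV. \<pi> $ s) = 1"

text \<open>\<open>\<pi> v* \<kappa>\<close> is the row vector \<open>\<pi>\<^sup>t \<kappa>\<close>, with \<open>s\<close>-th entry \<open>\<Sum>z. \<pi>\<^sub>z \<kappa>\<^sub>z\<^sub>s\<close>.\<close>

definition invariant_distribution :: "real ^ 'n ^ 'n \<Rightarrow> real ^ 'n \<Rightarrow> bool" where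
  "invariant_distribution \<kappa> \<pi> \<longleftrightarrow> distribution \<pi> \<and> \<pi> v* \<kappa> = \<pi>"

definition irreducible_kernel :: "real ^ 'n ^ 'n \<Rightarrow> bool" where
  "irreducible_kernel \<kappa> \<longleftrightarrow> (\<forall>z s. \<exists>n>0. matrix_power \<kappa> n $ z $ s > 0)"

end

theory Submission
  imports Defs
begin

text \<open>
  Existence is linear algebra. The rows of \<open>\<kappa>\<close> sum to \<open>1\<close>, so \<open>\<kappa> - mat 1\<close> annihilates the
  all-ones vector and is singular; hence so is its transpose, and some \<open>x \<noteq> 0\<close> satisfies
  \<open>x v* \<kappa> = x\<close>. The vector \<open>x\<close> may have mixed signs, but its entrywise absolute value is
  again invariant (\<open>invariant_vector_abs\<close>): the triangle inequality gives
  \<open>\<bar>x\<bar> \<le> \<bar>x\<bar> v* \<kappa>\<close> entrywise, and since \<open>\<kappa>\<close> preserves the total mass, no entry can increase.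
  Normalising \<open>\<bar>x\<bar>\<close> to mass \<open>1\<close> yields an invariant distribution.

  Uniqueness is where irreducibility enters. A nonnegative invariant vector with one positive
  entry has all entries positive, because mass at \<open>z\<close> reaches every \<open>s\<close> under some power of \<open>\<kappa>\<close>
  (\<open>nonneg_invariant_vector_pos\<close>). The positive part \<open>(\<bar>x\<bar> + x) / 2\<close> of an invariant vector
  is invariant, so an invariant vector with one positive entry is positive everywhere
  (\<open>invariant_vector_pos\<close>). The difference of two invariant distributions has mass \<open>0\<close>, so it
  cannot be positive everywhere, and neither can its negative; hence it vanishes.
\<close>

lemma sum_vector_matrix_mult:
  fixes \<kappa> :: "real ^ 'n ^ 'n"
  assumes "transition_kernel \<kappa>"
  shows "(\<Sum>s\<in>UNIV. (x v* \<kappa>) $ s) = (\<Sum>z\<in>UNIV. x $ z)"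
proof -
  have "(\<Sum>s\<in>UNIV. (x v* \<kappa>) $ s) = (\<Sum>s\<in>UNIV. \<Sum>z\<in>UNIV. x $ z * \<kappa> $ z $ s)"
    by (simp add: vector_matrix_mult_def)
  also have "\<dots> = (\<Sum>z\<in>UNIV. \<Sum>s\<in>UNIV. x $ z * \<kappa> $ z $ s)"
    by (rule sum.swap)
  also have "\<dots> = (\<Sum>z\<in>UNIV. x $ z)"
    using assms by (simp add: transition_kernel_def flip: sum_distrib_left)
  finally show ?thesis .
qed

lemma invariant_vector_matrix_power:
  fixes \<kappa> :: "real ^ 'n ^ 'n"
  assumes "x v* \<kappa> = x"
  shows "x v* matrix_power \<kappa> n = x"
  by (induction n) (simp_all add: assms flip: vector_matrix_mul_assoc)

lemma matrix_power_nonneg: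
  fixes \<kappa> :: "real ^ 'n ^ 'n"
  assumes "transition_kernel \<kappa>"
  shows "0 \<le> matrix_power \<kappa> n $ z $ s"
proof (induction n arbitrary: s)
  case 0
  show ?case by (simp add: mat_def)
next
  case (Suc n)
  then show ?case
    using assms by (auto simp: matrix_matrix_mult_def transition_kernel_def intro!: sum_nonneg)
qed

text \<open>
  The entrywise inequality \<open>\<bar>x\<bar> \<le> \<bar>x\<bar> v* \<kappa>\<close> is an equality because both sides have the same mass.
\<close>

lemma invariant_vector_abs:
  fixes \<kappa> :: "real ^ 'n ^ 'n"
  assumes ker: "transition_kernel \<kappa>" and inv: "x v* \<kappa> = x"
  shows "(\<chi> s. \<bar>x $ s\<bar>) v* \<kappa> = (\<chi> s. \<bar>x $ s\<bar>)"
proof -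
  define y :: "real ^ 'n" where "y = (\<chi> s. \<bar>x $ s\<bar>)"
  have le: "y $ s \<le> (y v* \<kappa>) $ s" for s
  proof -
    have "y $ s = \<bar>(x v* \<kappa>) $ s\<bar>"
      by (simp add: inv y_def)
    also have "\<dots> \<le> (\<Sum>z\<in>UNIV. \<bar>x $ z * \<kappa> $ z $ s\<bar>)"
      by (simp add: vector_matrix_mult_def sum_abs)
    also have "\<dots> = (y v* \<kappa>) $ s"
      using ker by (simp add: vector_matrix_mult_def y_def abs_mult transition_kernel_def)
    finally show ?thesis .
  qed
  have "(y v* \<kappa>) $ s = y $ s" for s
    using sum_mono_inv[of "\<lambda>s. y $ s" UNIV "\<lambda>s. (y v* \<kappa>) $ s" s] le
      sum_vector_matrix_mult[OF ker, of y] by simp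
  then show ?thesis
    by (simp add: vec_eq_iff y_def)
qed

lemma nonneg_invariant_vector_pos:
  fixes \<kappa> :: "real ^ 'n ^ 'n"
  assumes ker: "transition_kernel \<kappa>" and irr: "irreducible_kernel \<kappa>"
    and inv: "x v* \<kappa> = x" and nonneg: "\<And>s. 0 \<le> x $ s" and pos: "0 < x $ z"
  shows "0 < x $ s"
proof -
  obtain n where n: "0 < matrix_power \<kappa> n $ z $ s"
    using irr by (auto simp: irreducible_kernel_def)
  have "0 < x $ z * matrix_power \<kappa> n $ z $ s"
    using n pos by simp
  also have "\<dots> \<le> (\<Sum>w\<in>UNIV. x $ w * matrix_power \<kappa> n $ w $ s)"
    by (rule member_le_sum) (auto simp: matrix_power_nonneg[OF ker] nonneg)
  also have "\<dots> = (x v* matrix_power \<kappa> n) $ s"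
    by (simp add: vector_matrix_mult_def)
  also have "\<dots> = x $ s"
    by (simp add: invariant_vector_matrix_power[OF inv])
  finally show ?thesis .
qed

text \<open>
  Vectors of mixed sign reduce to nonnegative ones: the positive part of \<open>x\<close> is invariant and
  nonnegative, and where it is positive it agrees with \<open>x\<close>.
\<close>

lemma invariant_vector_pos:
  fixes \<kappa> :: "real ^ 'n ^ 'n"
  assumes ker: "transition_kernel \<kappa>" and irr: "irreducible_kernel \<kappa>"
    and inv: "x v* \<kappa> = x" and pos: "0 < x $ z"
  shows "0 < x $ s"
proof -
  (* Twice the positive part of x. *)
  define p where "p = (\<chi> s. \<bar>x $ s\<bar>) + x"
  have "p v* \<kappa> = p"
    by (simp add: p_def vector_matrix_left_distrib invariant_vector_abs[OF ker inv] inv)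
  moreover have "0 \<le> p $ t" for t
    by (simp add: p_def)
  moreover have "0 < p $ z"
    using pos by (simp add: p_def)
  ultimately have "0 < p $ s"
    by (rule nonneg_invariant_vector_pos[OF ker irr])
  then show ?thesis
    by (simp add: p_def)
qed

lemma invariant_vector_zero_if_sum_zero:
  fixes \<kappa> :: "real ^ 'n ^ 'n"
  assumes ker: "transition_kernel \<kappa>" and irr: "irreducible_kernel \<kappa>"
    and inv: "x v* \<kappa> = x" and sum0: "(\<Sum>s\<in>UNIV. x $ s) = 0"
  shows "x = 0"
proof -
  have nonpos: "y $ z \<le> 0" if y: "y v* \<kappa> = y" "(\<Sum>s\<in>UNIV. y $ s) = 0" for y :: "real ^ 'n" and z
  proof (rule ccontr)
    assume "\<not> y $ z \<le> 0"
    then have "0 < y $ s" for s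
      using invariant_vector_pos[OF ker irr y(1), of z s] by simp
    then have "0 < (\<Sum>s\<in>UNIV. y $ s)"
      by (intro sum_pos) auto
    with y(2) show False by simp
  qed
  have "(- x) v* \<kappa> = - x"
    using inv by (simp add: vector_matrix_mult_def vec_eq_iff sum_negf)
  then have "(- x) $ z \<le> 0" for z
    using sum0 by (intro nonpos) (simp_all add: sum_negf)
  with nonpos[OF inv sum0] show ?thesis
    by (simp add: vec_eq_iff antisym)
qed

text \<open>
  The all-ones vector is a right eigenvector for the eigenvalue \<open>1\<close>; since a matrix and its
  transpose have the same rank, there is also a left eigenvector.
\<close>

lemma ex_nonzero_invariant_vector:
  fixes \<kappa> :: "real ^ 'n ^ 'n"
  assumes "transition_kernel \<kappa>"
  shows "\<exists>x. x \<noteq> 0 \<and> x v* \<kappa> = x"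
proof -
  have "(\<kappa> - mat 1) *v 1 = 0"
    using assms
    by (simp add: matrix_vector_mult_diff_rdistrib)
      (simp add: vec_eq_iff matrix_vector_mult_def transition_kernel_def)
  moreover have "(1 :: real ^ 'n) \<noteq> 0"
    by simp
  ultimately have "rank (\<kappa> - mat 1) \<noteq> CARD('n)"
    using matrix_nonfull_linear_equations_eq by blast
  then have "rank (transpose (\<kappa> - mat 1)) \<noteq> CARD('n)"
    by (simp add: rank_transpose)
  then obtain x where x: "x \<noteq> 0" "transpose (\<kappa> - mat 1) *v x = 0"
    using matrix_nonfull_linear_equations_eq by blast
  have "x v* \<kappa> - x v* mat 1 = x v* (\<kappa> - mat 1)"
    by (simp add: vector_matrix_mult_def vec_eq_iff right_diff_distrib sum_subtractf)
  with x show ?thesis by auto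
qed

theorem theorem2:
  fixes \<kappa> :: "real ^ 'n ^ 'n"
  assumes "transition_kernel \<kappa>"
    and "irreducible_kernel \<kappa>"
  shows "\<exists>!\<pi>. invariant_distribution \<kappa> \<pi>"
proof (rule ex_ex1I)
  obtain x where x: "x \<noteq> 0" "x v* \<kappa> = x"
    using ex_nonzero_invariant_vector[OF assms(1)] by blast
  define c where "c = (\<Sum>s\<in>UNIV. \<bar>x $ s\<bar>)"
  define p :: "real ^ 'n" where "p = (1 / c) *\<^sub>R (\<chi> s. \<bar>x $ s\<bar>)"
  have le_c: "\<bar>x $ s\<bar> \<le> c" for s
    unfolding c_def by (rule member_le_sum) auto
  obtain z where "x $ z \<noteq> 0"
    using x(1) by (auto simp: vec_eq_iff)
  with le_c[of z] have "0 < c" by simp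
  with le_c have "distribution p"
    by (simp add: distribution_def p_def flip: sum_divide_distrib c_def)
  moreover have "p v* \<kappa> = p"
    by (simp add: p_def scaleR_vector_matrix_assoc invariant_vector_abs[OF assms(1) x(2)])
  ultimately show "\<exists>\<pi>. invariant_distribution \<kappa> \<pi>"
    by (auto simp: invariant_distribution_def)
next
  fix \<pi> \<mu>
  assume \<pi>: "invariant_distribution \<kappa> \<pi>" and \<mu>: "invariant_distribution \<kappa> \<mu>"
  have "(\<pi> - \<mu>) v* \<kappa> = \<pi> v* \<kappa> - \<mu> v* \<kappa>"
    by (rule vector_matrix_mult_diff_distrib)
  also have "\<dots> = \<pi> - \<mu>"
    using \<pi> \<mu> by (simp add: invariant_distribution_def)
  finally have "(\<pi> - \<mu>) v* \<kappa> = \<pi> - \<mu>" .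
  moreover have "(\<Sum>s\<in>UNIV. (\<pi> - \<mu>) $ s) = 0"
    using \<pi> \<mu> by (simp add: invariant_distribution_def distribution_def sum_subtractf)
  ultimately have "\<pi> - \<mu> = 0"
    by (rule invariant_vector_zero_if_sum_zero[OF assms])
  then show "\<pi> = \<mu>" by simp
qed

end
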